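(* Let $(\alpha_n)_{n\ge1}$ be an arbitrary sequence of positive integers, $u_1\in\mathbb Z_{>1}$ and $m\in\mathbb Z_{>0}$. Suppose the sequence $(u_n)_{n\ge1}$ satisfies either (A) $u_{n+2}u_n=\alpha_nu_{n+1}^3(u_{n+1}-1)$ for $n\ge1$, with $u_2=mu_1^2(u_1-1)$; or (B) $u_{n+2}=\alpha_nu_{n+1}^2(u_n-1)$ for $n\ge1$, with $u_2=mu_1$. Let $\varepsilon_j\in\{\pm1\}$ ($j\ge2$) be arbitrary signs and $$S=\frac1{u_1}+\sum_{j=2}^\infty\frac{\varepsilon_j}{u_1(u_1-1)\cdots u_{j-1}(u_{j-1}-1)u_j}.$$ Set $\rho_n=m\prod_{k=1}^{n-1}\alpha_k$ for $n\ge1$, and for $n\ge1$ let $z_{n+1}=u_n(u_n-1)^2\rho_n$ in case (A), and $z_{n+1}=(u_n-1)\rho_n$ in case (B). Define $\Phi_1=[0;u_1]$, $\Phi_2=\varphi_{z_2}^{(-\varepsilon_2)}(\Phi_1)$ and $\Phi_{n+1}=\varphi_{z_{n+1}}^{(\varepsilon_{n+1})}(\Phi_n)$ for $n\ge2$. Then for each $n\ge1$ the $n$th partial sum of $S$ equals $\Phi_n$, and the continued fraction expansion of $S$ is the limit of the $\Phi_n$: $$S=\cdots\varphi_{z_4}^{(\varepsilon_4)}\varphi_{z_3}^{(\varepsilon_3)}\varphi_{z_2}^{(-\varepsilon_2)}([0;u_1]).$$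
   Context: A finite regular continued fraction is $[a_0;a_1,\ldots,a_n]=a_0+1/(a_1+1/(\cdots+1/a_n))$ with $a_0\in\mathbb Z$, $a_i\in\mathbb Z_{>0}$. For $\mathbf a=(a_1,\ldots,a_n)$, $n\ge1$, let $\mathbf a^R=(a_n,\ldots,a_1)$, $\tilde{\mathbf a}=(a_1,\ldots,a_{n-1},a_n-1,1)$, and $\tilde{\mathbf a}^R$ its reversal. For a positive integer $z$: $\varphi_z^{(+1)}([a_0;\mathbf a])=[a_0;\mathbf a,z-1,\tilde{\mathbf a}^R]$ and $\varphi_z^{(-1)}([a_0;\mathbf a])=[a_0;\tilde{\mathbf a},z-1,\mathbf a^R]$. Whenever a zero partial quotient appears it is removed by the concatenation rule $[\ldots,A,0,B,\ldots]=[\ldots,A+B,\ldots]$. *)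

theory Defs
  imports Complex_Main
begin

text \<open>
  A finite continued fraction \<open>[a\<^sub>0; a\<^sub>1, \<dots>, a\<^sub>n]\<close> is kept as the list of its partial quotients
  \<open>a\<^sub>0 # [a\<^sub>1, \<dots>, a\<^sub>n]\<close>, not as a number: the maps below depend on which of the two regular
  expansions of a rational number is chosen.
\<close>

fun cf_value :: "int list \<Rightarrow> real" where
  "cf_value [] = 0"
| "cf_value [a] = of_int a"
| "cf_value (a # b # xs) = of_int a + 1 / cf_value (b # xs)"

definition regular_cf :: "int list \<Rightarrow> bool" where
  "regular_cf xs \<longleftrightarrow> xs \<noteq> [] \<and> (\<forall>a \<in> set (tl xs). a > 0)"

text \<open>
  The concatenation rule \<open>[\<dots>, A, 0, B, \<dots>] = [\<dots>, A + B, \<dots>]\<close>, applied from left to right until no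
  zero with a neighbour on both sides is left. The result does not depend on the order. A zero in
  the leading place \<open>a\<^sub>0\<close> is legitimate and stays.
\<close>

function remove_zeros :: "int list \<Rightarrow> int list" where
  "remove_zeros [] = []"
| "remove_zeros [a] = [a]"
| "remove_zeros [a, b] = [a, b]"
| "remove_zeros (a # b # c # xs) =
     (if b = 0 then remove_zeros ((a + c) # xs) else a # remove_zeros (b # c # xs))"
  by pat_completeness auto
termination by (relation "measure length") auto

definition cf_tilde :: "int list \<Rightarrow> int list" where
  "cf_tilde a = butlast a @ [last a - 1, 1]"

text \<open>
  \<open>cf_fold z \<sigma>\<close> is the map \<open>\<phi>\<^sub>z\<close> with sign \<open>\<sigma> \<in> {1, -1}\<close>; it is meant for lists \<open>a0 # a\<close> with
  \<open>a \<noteq> []\<close>.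
\<close>

fun cf_fold :: "int \<Rightarrow> int \<Rightarrow> int list \<Rightarrow> int list" where
  "cf_fold z \<sigma> [] = []"
| "cf_fold z \<sigma> (a0 # a) = remove_zeros (a0 #
     (if \<sigma> = 1 then a @ [z - 1] @ rev (cf_tilde a) else cf_tilde a @ [z - 1] @ rev a))"

definition is_cf_expansion :: "(nat \<Rightarrow> int) \<Rightarrow> real \<Rightarrow> bool" where
  "is_cf_expansion c x \<longleftrightarrow>
     (\<forall>i\<ge>1. c i > 0) \<and> (\<lambda>k. cf_value (map c [0..<Suc k])) \<longlonglongrightarrow> x"

text \<open>
  Convergence of finite continued fractions to an infinite one, partial quotient by partial
  quotient.
\<close>

definition cf_limit :: "(nat \<Rightarrow> int list) \<Rightarrow> (nat \<Rightarrow> int) \<Rightarrow> bool" where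
  "cf_limit \<Phi> c \<longleftrightarrow> (\<forall>i. \<forall>\<^sub>F n in sequentially. i < length (\<Phi> n) \<and> \<Phi> n ! i = c i)"

definition series_term :: "(nat \<Rightarrow> int) \<Rightarrow> (nat \<Rightarrow> int) \<Rightarrow> nat \<Rightarrow> real" where
  "series_term u \<epsilon> j =
     of_int (\<epsilon> j) / of_int ((\<Prod>k = 1..<j. u k * (u k - 1)) * u j)"

end

theory Submission
  imports Defs
begin

text \<open>
  The product \<open>M\<close> of the matrices \<open>(a, 1; 1, 0)\<close> over the partial quotients \<open>a\<close> has first column
  \<open>(p, q)\<close> with \<open>p / q\<close> the value of the continued fraction. Reversing a list transposes \<open>M\<close>,
  removing zeros does not change it, and \<open>cf_tilde\<close> multiplies it on the right by \<open>(1, 1; 0, -1)\<close>.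
  Together with \<open>det M = \<plusminus>1\<close> this shows that \<open>cf_fold\<close> sends \<open>(p, q)\<close> to \<open>(z p q \<plusminus> 1, z q\<^sup>2)\<close>.
  The nonlinear recurrence for \<open>u\<close> says precisely that the denominators \<open>D\<^sub>n\<close> of the series satisfy
  \<open>D\<^bsub>n+1\<^esub> = z\<^bsub>n+1\<^esub> D\<^sub>n\<^sup>2\<close>, so each fold adds the next term. A fold changes at most the last two
  partial quotients of the list it extends, so the lists converge, and a regular continued fraction
  differs from its convergent \<open>p / q\<close> by at most \<open>1 / q\<close>.
\<close>

section \<open>Continuant matrices acting on integer vectors\<close>

text \<open>\<open>cf_act xs v\<close> is \<open>M v\<close>.\<close>

definition cf_act :: "int list \<Rightarrow> int \<times> int \<Rightarrow> int \<times> int" where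
  "cf_act xs = foldr (\<lambda>a (x, y). (a * x + y, x)) xs"

lemma cf_act_Nil [simp]: "cf_act [] v = v"
  by (simp add: cf_act_def)

lemma cf_act_Cons [simp]:
  "cf_act (a # xs) v = (a * fst (cf_act xs v) + snd (cf_act xs v), fst (cf_act xs v))"
  by (simp add: cf_act_def case_prod_unfold)

lemma cf_act_append [simp]: "cf_act (xs @ ys) v = cf_act xs (cf_act ys v)"
  by (simp add: cf_act_def)

lemma cf_act_linear:
  "cf_act xs (x, y) =
     (x * fst (cf_act xs (1, 0)) + y * fst (cf_act xs (0, 1)),
      x * snd (cf_act xs (1, 0)) + y * snd (cf_act xs (0, 1)))"
  by (induction xs) (auto simp: algebra_simps)

text \<open>Each factor (a, 1; 1, 0) is symmetric, so transposing the product only reverses the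
  order of its factors. The transpose appears here through the bilinear pairing of \<open>w\<close>
  with \<open>M v\<close>.\<close>

lemma cf_act_rev:
  "fst w * fst (cf_act xs v) + snd w * snd (cf_act xs v) =
     fst (cf_act (rev xs) w) * fst v + snd (cf_act (rev xs) w) * snd v"
proof (induction xs arbitrary: w)
  case (Cons a xs)
  show ?case
    using Cons[of "(a * fst w + snd w, fst w)"] by (simp add: algebra_simps)
qed simp

lemma cf_act_det:
  "fst (cf_act xs v) * snd (cf_act xs w) - fst (cf_act xs w) * snd (cf_act xs v) =
     (-1) ^ length xs * (fst v * snd w - fst w * snd v)"
  by (induction xs) (auto simp: algebra_simps)

lemma cf_act_rev_fst: "cf_act (rev xs) (1, 0) = (fst (cf_act xs (1, 0)), fst (cf_act xs (0, 1)))"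
  using cf_act_rev[of "(1, 0)" xs "(1, 0)"] cf_act_rev[of "(1, 0)" xs "(0, 1)"]
  by (simp add: prod_eq_iff)

text \<open>Only the last entry \<open>l\<close> matters: (l - 1, 1; 1, 0)(1, 1; 1, 0) = (l, 1; 1,
  0)(1, 1; 0, -1).\<close>

lemma cf_act_tilde:
  assumes "a \<noteq> []"
  shows "cf_act (cf_tilde a) (x, y) = cf_act a (x + y, - y)"
proof -
  have "cf_act a w = cf_act (butlast a) (cf_act [last a] w)" for w
    by (metis append_butlast_last_id assms cf_act_append)
  then show ?thesis
    by (simp add: cf_tilde_def algebra_simps)
qed

section \<open>Effect of the concatenation rule on values, signs and lengths\<close>

lemma cf_act_remove_zeros: "cf_act (remove_zeros xs) v = cf_act xs v"
  by (induction xs rule: remove_zeros.induct) (auto simp: algebra_simps)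

lemma even_length_remove_zeros: "even (length (remove_zeros xs)) \<longleftrightarrow> even (length xs)"
  by (induction xs rule: remove_zeros.induct) auto

lemma remove_zeros_neq_Nil [simp]: "remove_zeros xs = [] \<longleftrightarrow> xs = []"
  by (induction xs rule: remove_zeros.induct) auto

lemma hd_remove_zeros_ge:
  assumes "\<forall>x\<in>set xs. x \<ge> 0"
  shows "a \<le> hd (remove_zeros (a # xs))"
  using assms by (induction "a # xs" arbitrary: a xs rule: remove_zeros.induct) force+

text \<open>A zero in the last place has no right neighbour and would survive, hence the condition
  on \<open>last xs\<close>. Elsewhere a nonzero entry can only grow by merging, so it stays
  positive.\<close>

lemma tl_remove_zeros_pos:
  assumes "\<forall>x\<in>set xs. x \<ge> 0" "xs \<noteq> [] \<longrightarrow> last xs > 0"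
  shows "\<forall>x\<in>set (tl (remove_zeros (a # xs))). x > 0"
  using assms
proof (induction "a # xs" arbitrary: a xs rule: remove_zeros.induct)
  case (4 a b c xs)
  show ?case
  proof (cases "b = 0")
    case True
    then show ?thesis using 4 by (auto split: if_splits)
  next
    case False
    have "remove_zeros (b # c # xs) =
        hd (remove_zeros (b # c # xs)) # tl (remove_zeros (b # c # xs))"
      by simp
    moreover have "hd (remove_zeros (b # c # xs)) > 0"
      using hd_remove_zeros_ge[of "c # xs" b] 4(3) False by auto
    moreover have "\<forall>x\<in>set (tl (remove_zeros (b # c # xs))). x > 0"
      using 4(2)[OF False] 4(3,4) by simp
    ultimately show ?thesis using False
      by (metis list.sel(3) remove_zeros.simps(4) set_ConsD)
  qed
qed auto

text \<open>Each merge shortens the list by two and uses up a zero of the tail. The sum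
  \<open>a + c\<close> becomes the new head, which is not counted, so merging creates no further
  zeros to pay for.\<close>

lemma length_remove_zeros_ge:
  "length xs + 1 \<le> length (remove_zeros (a # xs)) + 2 * count_list xs 0"
  by (induction "a # xs" arbitrary: a xs rule: remove_zeros.induct) force+

text \<open>A merge alters only the left neighbour of a zero. The nonzero \<open>c\<close> shields
  \<open>b\<close>, but may itself absorb part of \<open>ys\<close>, so it stays inside the
  recursive call.\<close>

lemma remove_zeros_append:
  assumes "\<forall>x\<in>set b. x \<noteq> 0" "c \<noteq> 0"
  shows "remove_zeros (a # b @ c # ys) = a # b @ remove_zeros (c # ys)"
  using assms
proof (induction b arbitrary: a)
  case Nil
  then show ?case by (cases ys) auto
next
  case (Cons x b)
  then show ?case by (cases b) auto
qed

section \<open>Growth of continuants and the error of a convergent\<close>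

text \<open>Linear growth, far below the true exponential rate, is enough to make the error of the
  convergents tend to 0. The last conjunct drives the induction: \<open>q\<close> adds at least 1 to
  \<open>a * p\<close> as soon as \<open>xs\<close> is nonempty.\<close>

lemma cf_act_pos:
  assumes "\<forall>x\<in>set xs. x > 0"
  shows "fst (cf_act xs (1, 0)) \<ge> 1 \<and> fst (cf_act xs (1, 0)) \<ge> int (length xs) \<and>
    0 \<le> snd (cf_act xs (1, 0)) \<and> snd (cf_act xs (1, 0)) \<le> fst (cf_act xs (1, 0)) \<and>
    (xs \<noteq> [] \<longrightarrow> snd (cf_act xs (1, 0)) \<ge> 1)"
  using assms
proof (induction xs)
  case (Cons a xs)
  define p q where "p = fst (cf_act xs (1, 0))" and "q = snd (cf_act xs (1, 0))"
  have pq: "p \<ge> 1" "p \<ge> int (length xs)" "q \<ge> 0" "xs \<noteq> [] \<Longrightarrow> q \<ge> 1"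
    using Cons by (auto simp: p_def q_def)
  have "a \<ge> 1" using Cons by auto
  then have ap: "a * p \<ge> p" using pq by (simp add: mult_le_cancel_right1)
  have "p + q \<ge> 1 + int (length xs)"
  proof (cases "xs = []")
    case True
    then have "int (length xs) = 0" by simp
    then show ?thesis using pq(1,3) by linarith
  next
    case False
    then show ?thesis using pq(2,4) by linarith
  qed
  then have "a * p + q \<ge> int (length (a # xs))" "a * p + q \<ge> 1" "a * p + q \<ge> p"
    using ap pq(1,3) by (simp_all only: length_Cons of_nat_Suc)
  then show ?case using pq(1,3) by (simp add: p_def q_def)
qed simp

text \<open>Positivity of the tail keeps every denominator nonzero, so the convention
  \<open>1 / 0 = 0\<close> never interferes. The leading quotient may have any sign.\<close>

lemma cf_value_eq:
  assumes "regular_cf xs"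
  shows "cf_value xs = of_int (fst (cf_act xs (1, 0))) / of_int (snd (cf_act xs (1, 0)))"
proof -
  have *: "cf_value (a # xs) =
      of_int (fst (cf_act (a # xs) (1, 0))) / of_int (snd (cf_act (a # xs) (1, 0)))"
    if "\<forall>x\<in>set xs. x > 0" for a xs
    using that
  proof (induction xs arbitrary: a)
    case (Cons b xs)
    have "fst (cf_act (b # xs) (1, 0)) \<ge> 1" "snd (cf_act (b # xs) (1, 0)) \<ge> 1"
      using cf_act_pos[OF Cons.prems] by blast+
    moreover have "cf_value (a # b # xs) =
        of_int a + of_int (snd (cf_act (b # xs) (1, 0))) / of_int (fst (cf_act (b # xs) (1, 0)))"
      using Cons.IH[of b] Cons.prems by simp
    ultimately show ?case
      by (subst (1 2) cf_act_Cons) (simp add: field_simps del: cf_act_Cons)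
  qed simp
  show ?thesis
    using assms *[of "tl xs" "hd xs"] unfolding regular_cf_def by (cases xs) auto
qed

text \<open>If \<open>ys\<close> acts as (x, y), the full fraction is (x p + y p') / (x q + y q').
  Subtracting p / q leaves the numerator y times the determinant, that is y or -y, and y \<le>
  x.\<close>

lemma cf_convergent_error:
  assumes "regular_cf (xs @ ys)" "length xs \<ge> 2"
  shows "\<bar>cf_value (xs @ ys) - cf_value xs\<bar> \<le> 1 / of_nat (length xs - 1)"
proof -
  have pos: "\<forall>x\<in>set (tl xs). x > 0" "\<forall>x\<in>set ys. x > 0" "xs \<noteq> []" "tl xs \<noteq> []"
    using assms by (cases xs; auto simp: regular_cf_def)+
  have xs: "xs = hd xs # tl xs" using pos by simp
  have reg: "regular_cf xs" using pos by (simp add: regular_cf_def)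
  define p q p' q' where "p = fst (cf_act xs (1, 0))" and "q = snd (cf_act xs (1, 0))"
    and "p' = fst (cf_act xs (0, 1))" and "q' = snd (cf_act xs (0, 1))"
  define x y where "x = fst (cf_act ys (1, 0))" and "y = snd (cf_act ys (1, 0))"
  have q: "q = fst (cf_act (tl xs) (1, 0))" unfolding q_def by (subst xs) simp
  have q': "q' = fst (cf_act (tl xs) (0, 1))" unfolding q'_def by (subst xs) simp
  \<comment> \<open>Reversal moves \<open>q'\<close> into the first column, where the positivity
    lemma applies to it.\<close>
  have "cf_act (rev (tl xs)) (1, 0) = (q, q')" by (simp add: cf_act_rev_fst q q')
  then have q'0: "q' \<ge> 0" using cf_act_pos[of "rev (tl xs)"] pos by simp
  have q1: "q \<ge> 1" "q \<ge> int (length xs - 1)" using cf_act_pos[OF pos(1)] by (auto simp: q)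
  have xy: "x \<ge> 1" "0 \<le> y" "y \<le> x" using cf_act_pos[OF pos(2)] by (auto simp: x_def y_def)
  have act: "cf_act (xs @ ys) (1, 0) = (x * p + y * p', x * q + y * q')"
    using cf_act_linear[of xs x y] by (simp add: x_def y_def p_def q_def p'_def q'_def)
  have det: "p * q' - p' * q = (-1) ^ length xs"
    using cf_act_det[of xs "(1,0)" "(0,1)"] by (simp add: p_def q_def p'_def q'_def)
  have Q: "x * q + y * q' \<ge> x * q" "x * q > 0" using xy q'0 q1 by auto
  have "cf_value (xs @ ys) - cf_value xs =
      of_int (x * p + y * p') / of_int (x * q + y * q') - of_int p / of_int q"
    by (simp add: cf_value_eq[OF assms(1)] cf_value_eq[OF reg] act p_def q_def del: cf_act_append)
  also have "\<dots> = of_int ((x * p + y * p') * q - p * (x * q + y * q')) / of_int ((x * q + y * q') * q)"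
    using Q q1 by (subst diff_frac_eq) (auto simp: mult.commute simp flip: of_int_mult of_int_add)
  also have "(x * p + y * p') * q - p * (x * q + y * q') = - y * (p * q' - p' * q)"
    by (simp add: algebra_simps)
  finally have "\<bar>cf_value (xs @ ys) - cf_value xs\<bar> = of_int y / of_int ((x * q + y * q') * q)"
    using Q q1 xy
    by (simp add: det abs_mult abs_divide power_abs flip: of_int_abs del: of_int_mult of_int_add)
  also have "\<dots> \<le> of_int x / of_int (x * q)"
  proof (rule frac_le)
    have "x * q + y * q' \<le> (x * q + y * q') * q"
      using mult_left_mono[of 1 q "x * q + y * q'"] Q q1 by simp
    then have "x * q \<le> (x * q + y * q') * q" using Q by linarith
    then show "(of_int (x * q)::real) \<le> of_int ((x * q + y * q') * q)" by (simp only: of_int_le_iff)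
    show "0 < (of_int (x * q)::real)" using Q by (simp only: of_int_0_less_iff)
  qed (use xy in auto)
  also have "\<dots> = 1 / of_int q" using xy by simp
  also have "\<dots> \<le> 1 / of_nat (length xs - 1)"
    using q1 assms(2) by (intro frac_le) (auto simp: of_nat_diff)
  finally show ?thesis .
qed

section \<open>The folding map: numerator, denominator and shape\<close>

text \<open>The entries appended after \<open>a\<close> or \<open>cf_tilde a\<close>, together with
  the tilde correction, give the vector (z q - q', q) or (z q + q', -q). Applying M, the q q' terms
  cancel in the denominator, and the numerator retains the determinant p q' - p' q.\<close>

lemma cf_act_fold:
  assumes "a \<noteq> []" "\<sigma> \<in> {1, -1}" "cf_act (a0 # a) (1, 0) = (p, q)"
  shows "cf_act (cf_fold z \<sigma> (a0 # a)) (1, 0) = (z * p * q + \<sigma> * (-1) ^ length a, z * q\<^sup>2)"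
proof -
  define p' q' where "p' = fst (cf_act (a0 # a) (0, 1))" and "q' = fst (cf_act a (0, 1))"
  have q: "q = fst (cf_act a (1, 0))" using assms(3) by simp
  have act: "cf_act (a0 # a) (x, y) = (x * p + y * p', x * q + y * q')" for x y
    using cf_act_linear[of "a0 # a" x y] unfolding assms(3) by (simp add: p'_def q'_def del: cf_act_Cons) simp
  have det: "p * q' - p' * q = - ((-1) ^ length a)"
    using cf_act_det[of "a0 # a" "(1,0)" "(0,1)"] unfolding assms(3) by (simp add: p'_def q'_def)
  consider "\<sigma> = 1" | "\<sigma> = -1" using assms(2) by auto
  then show ?thesis
  proof cases
    case 1
    have "cf_act (rev (cf_tilde a)) (1, 0) = (q, q - q')"
      using cf_act_linear[of a 1 "-1"]
      by (simp add: cf_act_rev_fst cf_act_tilde[OF assms(1)] q q'_def)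
    then have "cf_act (cf_fold z \<sigma> (a0 # a)) (1, 0) = cf_act (a0 # a) (z * q - q', q)"
      by (simp add: 1 cf_act_remove_zeros algebra_simps)
    also have "\<dots> = (z * p * q - (p * q' - p' * q), z * q\<^sup>2)"
      unfolding act by (simp add: algebra_simps power2_eq_square)
    finally show ?thesis using det 1 by simp
  next
    case 2
    have "cf_act (rev a) (1, 0) = (q, q')"
      by (simp add: cf_act_rev_fst q q'_def)
    then have "cf_act (cf_fold z \<sigma> (a0 # a)) (1, 0) = cf_act (a0 # a) (z * q + q', - q)"
      by (simp add: 2 cf_act_remove_zeros cf_act_tilde[OF assms(1)] algebra_simps)
    also have "\<dots> = (z * p * q + (p * q' - p' * q), z * q\<^sup>2)"
      unfolding act by (simp add: algebra_simps power2_eq_square)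
    finally show ?thesis using det 2 by simp
  qed
qed

text \<open>Zeros can arise only from \<open>z - 1\<close> and from the lowered last entry of
  \<open>a\<close>; the latter needs length at least 2, since a single entry exceeds 1. Each zero
  costs two places. For a single entry 1, the reversed tilde list would end in 0.\<close>

lemma cf_fold_shape:
  assumes pos: "\<forall>x\<in>set a. x > 0" and ne: "a \<noteq> []" and hd: "length a = 1 \<Longrightarrow> hd a > 1"
    and z: "z \<ge> 1"
  shows "regular_cf (cf_fold z \<sigma> (a0 # a))"
    and "odd (length (cf_fold z \<sigma> (a0 # a)))"
    and "2 * length a + 3 \<le> length (cf_fold z \<sigma> (a0 # a)) +
          2 * (of_bool (z = 1) + of_bool (length a \<ge> 2))"
proof -
  define k :: nat where "k = of_bool (z = 1) + of_bool (length a \<ge> 2)"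
  define pre where "pre = (if \<sigma> = 1 then a @ [z - 1] @ rev (cf_tilde a)
    else cf_tilde a @ [z - 1] @ rev a)"
  have fold: "cf_fold z \<sigma> (a0 # a) = remove_zeros (a0 # pre)"
    by (simp add: pre_def)
  obtain b l where a: "a = b @ [l]" using ne by (metis append_butlast_last_id)
  have til: "cf_tilde a = b @ [l - 1, 1]" by (simp add: cf_tilde_def a)
  have len: "length pre = 2 * length a + 2" unfolding pre_def til by (simp add: a)
  have l: "l > 0" "b = [] \<Longrightarrow> l > 1" "\<forall>x\<in>set b. x > 0" using pos hd by (auto simp: a)
  have "count_list b 0 = 0" using l by (auto simp: count_list_0_iff)
  then have cnt: "count_list pre 0 \<le> k"
    unfolding k_def pre_def til using l by (cases "b = []") (auto simp: a Suc_le_eq)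
  have nonneg: "\<forall>x\<in>set pre. x \<ge> 0" unfolding pre_def til using l z by (auto simp: a)
  have last: "last pre > 0" unfolding pre_def til using l by (cases b) (auto simp: a)
  show "regular_cf (cf_fold z \<sigma> (a0 # a))"
    unfolding fold regular_cf_def using tl_remove_zeros_pos[OF nonneg] last by auto
  show "odd (length (cf_fold z \<sigma> (a0 # a)))"
    unfolding fold even_length_remove_zeros using len by auto
  show "2 * length a + 3 \<le> length (cf_fold z \<sigma> (a0 # a)) +
          2 * (of_bool (z = 1) + of_bool (length a \<ge> 2))"
    unfolding fold k_def[symmetric] using length_remove_zeros_ge[of pre a0] cnt len by linarith
qed

text \<open>Writing \<open>a = b @ [c, d]\<close>, both signs produce a list that begins with
  \<open>a0 # b @ [c]\<close> before zeros are removed. The entry \<open>c\<close> can still absorb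
  its successor when \<open>d - 1 = 0\<close>, so only \<open>a0 # b\<close> is safe.\<close>

lemma cf_fold_nth:
  assumes "\<forall>x\<in>set a. x > 0" "i < length a - 1"
  shows "cf_fold z \<sigma> (a0 # a) ! i = (a0 # a) ! i"
proof -
  have "length a \<ge> 2" using assms by simp
  obtain b c d where a: "a = b @ [c, d]"
  proof -
    have "a = take (length a - 2) a @ drop (length a - 2) a" by simp
    moreover have "length (drop (length a - 2) a) = Suc (Suc 0)" using \<open>length a \<ge> 2\<close> by simp
    then obtain c d where "drop (length a - 2) a = [c, d]"
      unfolding length_Suc_conv length_0_conv by auto
    ultimately show ?thesis using that by metis
  qed
  have b: "\<forall>x\<in>set b. x \<noteq> 0" "c \<noteq> 0" using assms by (auto simp: a)
  have "\<exists>ys. cf_fold z \<sigma> (a0 # a) = remove_zeros (a0 # b @ c # ys)"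
    by (auto simp: a cf_tilde_def butlast_append)
  then obtain ys where fold: "cf_fold z \<sigma> (a0 # a) = (a0 # b) @ remove_zeros (c # ys)"
    using remove_zeros_append[OF b] by auto
  have "a0 # a = (a0 # b) @ [c, d]" "i < length (a0 # b)" using assms by (simp_all add: a)
  then show ?thesis
    unfolding fold by (simp only: nth_append if_True)
qed

section \<open>From stabilising finite expansions to an infinite one\<close>

lemma cf_limit_expansion:
  assumes reg: "\<And>n. regular_cf (\<Phi> n)"
    and len: "\<And>n. length (\<Phi> n) \<ge> n + 3"
    and pref: "\<And>n i. i + 2 < length (\<Phi> n) \<Longrightarrow> \<Phi> (Suc n) ! i = \<Phi> n ! i"
    and lim: "(\<lambda>n. cf_value (\<Phi> n)) \<longlonglongrightarrow> S"
  shows "\<exists>c. cf_limit \<Phi> c \<and> is_cf_expansion c S"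
proof -
  \<comment> \<open>The diagonal works because length at least n + 3 puts every position i \<le> n
    of \<open>\<Phi> n\<close> outside its last two entries.\<close>
  define c where "c i = \<Phi> i ! i" for i
  have stable: "\<Phi> n ! i = c i" if "n \<ge> i" for n i
    using that
  proof (induction n rule: dec_induct)
    case base
    then show ?case by (simp add: c_def)
  next
    case (step n)
    then show ?case using pref[of i n] len[of n] by simp
  qed
  have "cf_limit \<Phi> c"
    unfolding cf_limit_def
  proof
    fix i
    have "i < length (\<Phi> n) \<and> \<Phi> n ! i = c i" if "n \<ge> i" for n
      using stable[OF that] len[of n] that by simp
    then show "\<forall>\<^sub>F n in sequentially. i < length (\<Phi> n) \<and> \<Phi> n ! i = c i"
      by (auto simp: eventually_sequentially)
  qed
  moreover have "c i > 0" if "i \<ge> 1" for i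
  proof -
    have "c i \<in> set (tl (\<Phi> i))"
      using nth_mem[of "i - 1" "tl (\<Phi> i)"] that len[of i] by (simp add: c_def nth_tl)
    then show ?thesis using reg[of i] by (simp add: regular_cf_def)
  qed
  moreover have "(\<lambda>k. cf_value (map c [0..<Suc k])) \<longlonglongrightarrow> S"
  proof -
    \<comment> \<open>For fixed \<open>k\<close>, the prefix of \<open>c\<close> is a convergent of
      every \<open>\<Phi> n\<close> with n \<ge> k, with an error bound independent of
      \<open>n\<close>; then n tends to infinity.\<close>
    have bound: "\<bar>cf_value (map c [0..<Suc k]) - S\<bar> \<le> 1 / of_nat k" if k: "k \<ge> 1" for k
    proof -
      have *: "\<bar>cf_value (\<Phi> n) - cf_value (map c [0..<Suc k])\<bar> \<le> 1 / of_nat k" if "n \<ge> k" for n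
      proof -
        have "map c [0..<Suc k] = take (Suc k) (\<Phi> n)"
          using stable[of _ n] len[of n] that by (intro nth_equalityI) (auto simp del: upt_Suc)
        then have "map c [0..<Suc k] @ drop (Suc k) (\<Phi> n) = \<Phi> n"
          by (simp only: append_take_drop_id)
        moreover have "length (map c [0..<Suc k]) = Suc k" by simp
        ultimately show ?thesis
          using cf_convergent_error[of "map c [0..<Suc k]" "drop (Suc k) (\<Phi> n)"] reg[of n] k
          by (simp del: upt_Suc)
      qed
      have "(\<lambda>n. \<bar>cf_value (\<Phi> n) - cf_value (map c [0..<Suc k])\<bar>)
          \<longlonglongrightarrow> \<bar>S - cf_value (map c [0..<Suc k])\<bar>"
        by (intro tendsto_intros lim)
      then have "\<bar>S - cf_value (map c [0..<Suc k])\<bar> \<le> 1 / of_nat k"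
        by (rule LIMSEQ_le_const2) (use * in blast)
      then show ?thesis by (simp add: abs_minus_commute)
    qed
    have "(\<lambda>k. cf_value (map c [0..<Suc k]) - S) \<longlonglongrightarrow> 0"
    proof (rule tendsto_0_le[OF lim_1_over_n, where K = 1])
      show "\<forall>\<^sub>F k in sequentially. norm (cf_value (map c [0..<Suc k]) - S) \<le>
          norm (1 / of_nat k :: real) * 1"
        using bound by (auto simp: eventually_sequentially simp del: upt_Suc)
    qed
    then show ?thesis by (rule LIM_zero_cancel)
  qed
  ultimately show ?thesis by (auto simp: is_cf_expansion_def)
qed

section \<open>The two recurrences and the denominators of the series\<close>

text \<open>Induction gives the first-order form
  \<open>u (Suc n) = u n * (u n - 1) * \<rho> n * D n\<close>; multiplying it by
  \<open>u n - 1\<close> yields the identity for \<open>z\<close>.\<close>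

lemma recurrence_A:
  fixes \<alpha> u \<rho> z D :: "nat \<Rightarrow> int"
  assumes alpha: "\<And>k. k \<ge> 1 \<Longrightarrow> \<alpha> k > 0"
    and u1: "u 1 > 1"
    and rho: "\<rho> 1 > 0" "\<And>k. k \<ge> 1 \<Longrightarrow> \<rho> (Suc k) = \<alpha> k * \<rho> k"
    and D: "D 1 = u 1" "\<And>k. k \<ge> 1 \<Longrightarrow> D (Suc k) = D k * (u k - 1) * u (Suc k)"
    and u2: "u 2 = \<rho> 1 * u 1 ^ 2 * (u 1 - 1)"
    and rec: "\<And>k. k \<ge> 1 \<Longrightarrow> u (k + 2) * u k = \<alpha> k * u (k + 1) ^ 3 * (u (k + 1) - 1)"
    and z: "\<And>k. k \<ge> 1 \<Longrightarrow> z (k + 1) = u k * (u k - 1) ^ 2 * \<rho> k"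
    and n: "n \<ge> 1"
  shows "u n \<ge> 2 \<and> z (n + 1) * D n = (u n - 1) * u (n + 1) \<and> z (n + 1) \<ge> 2"
proof -
  have rho_pos: "\<rho> k > 0" if "k \<ge> 1" for k
    using that by (induction k rule: dec_induct) (use rho alpha in auto)
  have "u n \<ge> 2 \<and> D n > 0 \<and> u (Suc n) = u n * (u n - 1) * \<rho> n * D n"
    using n
  proof (induction n rule: dec_induct)
    case base
    show ?case using u1 u2 D(1) by (simp add: numeral_2_eq_2 algebra_simps)
  next
    case (step k)
    then have "u k * (u k - 1) * \<rho> k * D k > 0" and "u k * (u k - 1) * (\<rho> k * D k) \<ge> 2 * 1 * 1"
      using rho_pos[of k]
      by (simp, intro mult_mono) (auto simp: int_one_le_iff_zero_less)
    moreover have uk: "u (Suc k) = u k * (u k - 1) * \<rho> k * D k" using step.IH by blast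
    ultimately have uS: "u (Suc k) \<ge> 2" using step by (simp add: mult.assoc)
    then have DS: "D (Suc k) > 0" using step D(2)[of k] by simp
    \<comment> \<open>The induction hypothesis replaces just one factor \<open>u (Suc k)\<close>;
      the common factor \<open>u k\<close> is cancelled at the end.\<close>
    have "u (Suc (Suc k)) * u k = (\<alpha> k * u (Suc k) ^ 2 * (u (Suc k) - 1)) * u (Suc k)"
      using rec[of k] step(1) by (simp add: power2_eq_square power3_eq_cube algebra_simps)
    also have "\<dots> = (\<alpha> k * u (Suc k) ^ 2 * (u (Suc k) - 1)) * (u k * (u k - 1) * \<rho> k * D k)"
      by (rule arg_cong[OF uk])
    also have "\<dots> = (u (Suc k) * (u (Suc k) - 1) * \<rho> (Suc k) * D (Suc k)) * u k"
      using step(1) by (simp add: rho(2) D(2) power2_eq_square algebra_simps)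
    finally show ?case using uS DS step by simp
  qed
  moreover from this have "u n * (u n - 1) ^ 2 * \<rho> n \<ge> 2 * 1 ^ 2 * 1"
    using rho_pos[OF n] by (intro mult_mono power_mono) auto
  ultimately show ?thesis using z[OF n] by (simp add: power2_eq_square)
qed

text \<open>The invariant is \<open>u (Suc n) = \<rho> n * D n\<close>. Here \<open>z\<close> can be
  1 at the first two folds, if u = 2 and \<rho> = 1 there; from n = 3 on, u n \<ge> 4 excludes
  this.\<close>

lemma recurrence_B:
  fixes \<alpha> u \<rho> z D :: "nat \<Rightarrow> int"
  assumes alpha: "\<And>k. k \<ge> 1 \<Longrightarrow> \<alpha> k > 0"
    and u1: "u 1 > 1"
    and rho: "\<rho> 1 > 0" "\<And>k. k \<ge> 1 \<Longrightarrow> \<rho> (Suc k) = \<alpha> k * \<rho> k"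
    and D: "D 1 = u 1" "\<And>k. k \<ge> 1 \<Longrightarrow> D (Suc k) = D k * (u k - 1) * u (Suc k)"
    and u2: "u 2 = \<rho> 1 * u 1"
    and rec: "\<And>k. k \<ge> 1 \<Longrightarrow> u (k + 2) = \<alpha> k * u (k + 1) ^ 2 * (u k - 1)"
    and z: "\<And>k. k \<ge> 1 \<Longrightarrow> z (k + 1) = (u k - 1) * \<rho> k"
    and n: "n \<ge> 1"
  shows "u n \<ge> 2 \<and> z (n + 1) * D n = (u n - 1) * u (n + 1) \<and> z (n + 1) \<ge> 1 \<and>
    (n \<ge> 3 \<longrightarrow> z (n + 1) \<ge> 2)"
proof -
  have rho_pos: "\<rho> k > 0" if "k \<ge> 1" for k
    using that by (induction k rule: dec_induct) (use rho alpha in auto)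
  have step4: "u (k + 2) \<ge> 4" if "k \<ge> 1" "u k \<ge> 2" "u (k + 1) \<ge> 2" for k
  proof -
    have "\<alpha> k * u (k + 1) ^ 2 * (u k - 1) \<ge> 1 * 2 ^ 2 * 1"
      using that alpha[OF that(1)] by (intro mult_mono power_mono) auto
    then show ?thesis using rec[OF that(1)] by simp
  qed
  have main: "u k \<ge> 2 \<and> u (Suc k) \<ge> 2 \<and> u (Suc k) = \<rho> k * D k" if "k \<ge> 1" for k
    using that
  proof (induction k rule: dec_induct)
    case base
    have "\<rho> 1 * u 1 \<ge> 1 * 2" using rho(1) u1 by (intro mult_mono) auto
    then show ?case using u1 u2 D(1) by (simp add: numeral_2_eq_2)
  next
    case (step k)
    have "u (Suc (Suc k)) = (\<alpha> k * u (Suc k) * (u k - 1)) * u (Suc k)"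
      using rec[of k] step(1) by (simp add: power2_eq_square algebra_simps)
    also have "\<dots> = (\<alpha> k * u (Suc k) * (u k - 1)) * (\<rho> k * D k)"
      using step.IH by (intro arg_cong[where f = "(*) _"]) blast
    also have "\<dots> = \<rho> (Suc k) * D (Suc k)"
      using step(1) by (simp add: rho(2) D(2) algebra_simps)
    finally show ?case using step step4[of k] by simp
  qed
  have "(u n - 1) * \<rho> n \<ge> 1 * 1"
    using main[OF n] rho_pos[OF n] by (intro mult_mono) auto
  moreover have "(u n - 1) * \<rho> n \<ge> 2 * 1" if "n \<ge> 3"
  proof (rule mult_mono)
    have "n - 2 \<ge> 1" "Suc (Suc (n - 2)) = n" using that by auto
    then have "u n \<ge> 4" using step4[of "n - 2"] main[of "n - 2"] by simp
    then show "2 \<le> u n - 1" "0 \<le> u n - 1" by auto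
  qed (use rho_pos[OF n] in auto)
  ultimately show ?thesis using main[OF n] z[OF n] by simp
qed

section \<open>Folding as summation of the series, and passage to the limit\<close>

theorem theorem3p4:
  fixes \<alpha> u \<epsilon> \<rho> z :: "nat \<Rightarrow> int" and m :: int and S :: real and \<Phi> :: "nat \<Rightarrow> int list"
  assumes alpha_pos: "\<forall>n\<ge>1. \<alpha> n > 0"
    and u1: "u 1 > 1"
    and m_pos: "m > 0"
    and eps: "\<forall>j\<ge>2. \<epsilon> j \<in> {1, -1}"
    and rho: "\<forall>n\<ge>1. \<rho> n = m * (\<Prod>k = 1..<n. \<alpha> k)"
    and cases:
      "((\<forall>n\<ge>1. u (n + 2) * u n = \<alpha> n * u (n + 1) ^ 3 * (u (n + 1) - 1)) \<and>
        u 2 = m * u 1 ^ 2 * (u 1 - 1) \<and>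
        (\<forall>n\<ge>1. z (n + 1) = u n * (u n - 1) ^ 2 * \<rho> n))
       \<or>
       ((\<forall>n\<ge>1. u (n + 2) = \<alpha> n * u (n + 1) ^ 2 * (u n - 1)) \<and>
        u 2 = m * u 1 \<and>
        (\<forall>n\<ge>1. z (n + 1) = (u n - 1) * \<rho> n))"
    and S: "S = 1 / of_int (u 1) + (\<Sum>i. series_term u \<epsilon> (i + 2))"
    and Phi_1: "\<Phi> 1 = [0, u 1]"
    and Phi_2: "\<Phi> 2 = cf_fold (z 2) (- \<epsilon> 2) (\<Phi> 1)"
    and Phi_step: "\<forall>n\<ge>2. \<Phi> (n + 1) = cf_fold (z (n + 1)) (\<epsilon> (n + 1)) (\<Phi> n)"
  shows "summable (\<lambda>i. series_term u \<epsilon> (i + 2)) \<and>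
    (\<forall>n\<ge>1. regular_cf (\<Phi> n) \<and>
       1 / of_int (u 1) + (\<Sum>j = 2..n. series_term u \<epsilon> j) = cf_value (\<Phi> n)) \<and>
    (\<lambda>n. cf_value (\<Phi> n)) \<longlonglongrightarrow> S \<and>
    (\<exists>c. cf_limit \<Phi> c \<and> is_cf_expansion c S)"
proof -
  define D where "D n = (\<Prod>k = 1..<n. u k * (u k - 1)) * u n" for n
  have D: "D 1 = u 1" "\<And>k. k \<ge> 1 \<Longrightarrow> D (Suc k) = D k * (u k - 1) * u (Suc k)"
    by (simp_all add: D_def prod.atLeastLessThan_Suc)
  have rho': "\<rho> 1 = m" "\<And>k. k \<ge> 1 \<Longrightarrow> \<rho> (Suc k) = \<alpha> k * \<rho> k"
    using rho by (simp_all add: prod.atLeastLessThan_Suc)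
  \<comment> \<open>Cases (A) and (B) enter the rest of the argument only through these common
    consequences.\<close>
  have rec: "u n \<ge> 2 \<and> z (n + 1) * D n = (u n - 1) * u (n + 1) \<and> z (n + 1) \<ge> 1 \<and>
    (n \<ge> 3 \<longrightarrow> z (n + 1) \<ge> 2)" if n: "n \<ge> 1" for n
    using cases
  proof (elim disjE conjE)
    assume A: "\<forall>n\<ge>1. u (n + 2) * u n = \<alpha> n * u (n + 1) ^ 3 * (u (n + 1) - 1)"
      "u 2 = m * u 1 ^ 2 * (u 1 - 1)" "\<forall>n\<ge>1. z (n + 1) = u n * (u n - 1) ^ 2 * \<rho> n"
    have "u n \<ge> 2 \<and> z (n + 1) * D n = (u n - 1) * u (n + 1) \<and> z (n + 1) \<ge> 2"
      by (rule recurrence_A[where \<alpha> = \<alpha> and \<rho> = \<rho>])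
        (use A alpha_pos u1 m_pos rho' D n in auto)
    then show ?thesis by simp
  next
    assume B: "\<forall>n\<ge>1. u (n + 2) = \<alpha> n * u (n + 1) ^ 2 * (u n - 1)"
      "u 2 = m * u 1" "\<forall>n\<ge>1. z (n + 1) = (u n - 1) * \<rho> n"
    show ?thesis
      by (rule recurrence_B[where \<alpha> = \<alpha> and \<rho> = \<rho>])
        (use B alpha_pos u1 m_pos rho' D n in auto)
  qed
  have DS: "D (Suc n) = z (Suc n) * (D n)\<^sup>2" if "n \<ge> 1" for n
  proof -
    have "z (Suc n) * (D n)\<^sup>2 = (z (n + 1) * D n) * D n" by (simp add: power2_eq_square)
    also have "\<dots> = (u n - 1) * u (n + 1) * D n" using rec[OF that] by simp
    also have "\<dots> = D (Suc n)" using D(2)[OF that] by simp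
    finally show ?thesis by simp
  qed
  have D_ge: "D n \<ge> 2 ^ n" if "n \<ge> 1" for n
    using that
  proof (induction n rule: dec_induct)
    case base
    show ?case using u1 D(1) by simp
  next
    case (step n)
    have "(2::int) \<le> 2 ^ n" using step(1) self_le_power[of "2::int" n] by simp
    then have "1 * (2 * 2 ^ n) \<le> z (Suc n) * (D n * D n)"
      using step rec[of n] by (intro mult_mono) auto
    then show ?case using DS[OF step(1)] by (simp add: power2_eq_square)
  qed
  have D_pos: "D n > 0" if "n \<ge> 1" for n
    using D_ge[OF that] by (smt (verit) zero_less_power)
  have series_term_Suc: "series_term u \<epsilon> (Suc n) = of_int (\<epsilon> (Suc n)) / of_int (D (Suc n))" for n
    by (simp add: series_term_def D_def)

  \<comment> \<open>A fold contributes the sign \<sigma> (-1)^(length a). The tail of [0; u_1] has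
    odd length and all later tails even length, which explains the single flipped sign at the first
    fold.\<close>
  define \<sigma> where "\<sigma> n = (if n = 1 then - \<epsilon> 2 else \<epsilon> (n + 1))" for n
  have Phi_Suc: "\<Phi> (Suc n) = cf_fold (z (Suc n)) (\<sigma> n) (\<Phi> n)" if "n \<ge> 1" for n
    using that Phi_2 Phi_step by (cases "n = 1") (auto simp: \<sigma>_def numeral_2_eq_2)
  have sigma: "\<sigma> n \<in> {1, -1}" if "n \<ge> 1" for n
    using that eps by (auto simp: \<sigma>_def)
  define inv where "inv n \<longleftrightarrow> regular_cf (\<Phi> n) \<and> snd (cf_act (\<Phi> n) (1, 0)) = D n \<and>
      (if n = 1 then \<Phi> n = [0, u 1] else odd (length (\<Phi> n)) \<and> length (\<Phi> n) \<ge> 3)" for n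
  have fold_step: "inv (Suc n) \<and> cf_value (\<Phi> (Suc n)) = cf_value (\<Phi> n) + series_term u \<epsilon> (Suc n) \<and>
      (n \<ge> 3 \<longrightarrow> length (\<Phi> (Suc n)) \<ge> length (\<Phi> n) + 2) \<and>
      (\<forall>i. i + 2 < length (\<Phi> n) \<longrightarrow> \<Phi> (Suc n) ! i = \<Phi> n ! i)"
    if n: "n \<ge> 1" and "inv n" for n
  proof -
    have reg: "regular_cf (\<Phi> n)" and den: "snd (cf_act (\<Phi> n) (1, 0)) = D n"
      and len1: "n = 1 \<Longrightarrow> \<Phi> n = [0, u 1]"
      and len2: "n \<noteq> 1 \<Longrightarrow> odd (length (\<Phi> n)) \<and> length (\<Phi> n) \<ge> 3"
      using \<open>inv n\<close> by (auto simp: inv_def split: if_splits)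
    obtain a0 a where a: "\<Phi> n = a0 # a" using reg by (cases "\<Phi> n") (auto simp: regular_cf_def)
    have pos: "\<forall>x\<in>set a. x > 0" using reg a by (auto simp: regular_cf_def)
    have len2': "n \<noteq> 1 \<Longrightarrow> even (length a) \<and> length a \<ge> 2" using len2 a by auto
    have ne: "a \<noteq> []" and hd: "length a = 1 \<Longrightarrow> hd a > 1"
      using len1 len2' a u1 by (cases "n = 1"; force)+
    have z: "z (Suc n) \<ge> 1" and z2: "n \<ge> 3 \<Longrightarrow> z (Suc n) \<ge> 2" using rec[OF n] by auto
    define p where "p = fst (cf_act (\<Phi> n) (1, 0))"
    have pq: "cf_act (a0 # a) (1, 0) = (p, D n)"
      using den unfolding p_def a by (metis prod.collapse)
    have fold: "\<Phi> (Suc n) = cf_fold (z (Suc n)) (\<sigma> n) (a0 # a)"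
      using Phi_Suc[OF n] a by simp
    have "\<sigma> n * (-1) ^ length a = \<epsilon> (Suc n)"
    proof (cases "n = 1")
      case True
      then show ?thesis using len1 a by (auto simp: \<sigma>_def numeral_2_eq_2)
    next
      case False
      then show ?thesis using len2' by (simp add: \<sigma>_def)
    qed
    then have act: "cf_act (\<Phi> (Suc n)) (1, 0) = (z (Suc n) * p * D n + \<epsilon> (Suc n), D (Suc n))"
      unfolding fold cf_act_fold[OF ne sigma[OF n] pq] DS[OF n] by simp
    note shape = cf_fold_shape[OF pos ne hd z, of "\<sigma> n" a0, folded fold]
    \<comment> \<open>Worst cases: 5 places minus one removal of two for n = 1, and at least 7 minus
      two such removals afterwards.\<close>
    have "length (\<Phi> (Suc n)) \<ge> 3"
      using shape(3) len1 len2' a by (cases "n = 1") (auto split: if_splits simp: of_bool_def)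
    then have "inv (Suc n)"
      using shape(1,2) act n by (simp add: inv_def)
    moreover have "cf_value (\<Phi> (Suc n)) = cf_value (\<Phi> n) + series_term u \<epsilon> (Suc n)"
    proof -
      have "cf_value (\<Phi> (Suc n)) =
          of_int (z (Suc n) * p * D n + \<epsilon> (Suc n)) / of_int (z (Suc n) * (D n)\<^sup>2)"
        by (simp add: cf_value_eq[OF shape(1)] act DS[OF n])
      also have "\<dots> = of_int p / of_int (D n) + of_int (\<epsilon> (Suc n)) / of_int (z (Suc n) * (D n)\<^sup>2)"
        using z D_pos[OF n] by (simp add: divide_simps power2_eq_square)
      finally show ?thesis
        by (simp add: cf_value_eq[OF reg] den series_term_Suc DS[OF n] p_def)
    qed
    \<comment> \<open>With z \<ge> 2 at most one zero occurs, so the new length is at least 2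
      \<open>length a\<close> + 1, and \<open>length a\<close> is at least 2.\<close>
    moreover have "length (\<Phi> (Suc n)) \<ge> length (\<Phi> n) + 2" if "n \<ge> 3"
      using shape(3) z2[OF that] len2' that a by auto
    moreover have "\<Phi> (Suc n) ! i = \<Phi> n ! i" if "i + 2 < length (\<Phi> n)" for i
      using cf_fold_nth[OF pos, of i] that unfolding fold a by simp
    ultimately show ?thesis by blast
  qed
  have inv: "inv n" if "n \<ge> 1" for n
    using that
  proof (induction n rule: dec_induct)
    case base
    show ?case using Phi_1 u1 D(1) by (simp add: regular_cf_def inv_def)
  qed (use fold_step in blast)
  have partial: "1 / of_int (u 1) + (\<Sum>j = 2..n. series_term u \<epsilon> j) = cf_value (\<Phi> n)"
    if "n \<ge> 1" for n
    using that
  proof (induction n rule: dec_induct)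
    case base
    show ?case using Phi_1 by simp
  next
    case (step n)
    then show ?case using fold_step[OF _ inv, of n] by simp
  qed
  have summable: "summable (\<lambda>i. series_term u \<epsilon> (i + 2))"
  proof (rule summable_comparison_test')
    show "summable (\<lambda>i. (1 / 2) ^ i :: real)" by (rule summable_geometric) simp
    fix i :: nat
    have "2 ^ i \<le> (2::int) ^ (i + 2)" by simp
    then have "2 ^ i \<le> D (i + 2)" using D_ge[of "i + 2"] by linarith
    then have "(2::real) ^ i \<le> of_int (D (i + 2))"
      by (metis of_int_le_iff of_int_numeral of_int_power)
    moreover have "\<bar>of_int (\<epsilon> (i + 2)) :: real\<bar> = 1"
      using eps[rule_format, of "i + 2"] by auto
    ultimately show "norm (series_term u \<epsilon> (i + 2)) \<le> (1 / 2) ^ i"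
      using series_term_Suc[of "i + 1"] D_pos[of "i + 2"]
      by (simp add: abs_divide power_one_over frac_le)
  qed
  have shift: "(\<Sum>i<n. series_term u \<epsilon> (i + 2)) = (\<Sum>j = 2..n + 1. series_term u \<epsilon> j)" for n
    by (induction n) auto
  have "(\<lambda>n. 1 / of_int (u 1) + (\<Sum>i<n. series_term u \<epsilon> (i + 2))) \<longlonglongrightarrow> S"
    unfolding S by (intro tendsto_intros summable_LIMSEQ summable)
  then have "(\<lambda>n. cf_value (\<Phi> (n + 1))) \<longlonglongrightarrow> S"
    unfolding shift by (simp only: partial le_add2)
  then have lim: "(\<lambda>n. cf_value (\<Phi> n)) \<longlonglongrightarrow> S"
    by (rule LIMSEQ_offset)
  \<comment> \<open>The shift by 3 skips the early folds, where z = 1 may prevent the list from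
    growing; the limit notion ignores finitely many indices.\<close>
  have "\<exists>c. cf_limit (\<lambda>n. \<Phi> (n + 3)) c \<and> is_cf_expansion c S"
  proof (rule cf_limit_expansion)
    show "regular_cf (\<Phi> (n + 3))" for n using inv[of "n + 3"] by (simp add: inv_def)
    show "length (\<Phi> (n + 3)) \<ge> n + 3" for n
    proof (induction n)
      case 0
      show ?case using inv[of 3] by (simp add: inv_def)
    next
      case (Suc n)
      then show ?case using fold_step[OF _ inv, of "n + 3"] by simp
    qed
    show "\<Phi> (Suc n + 3) ! i = \<Phi> (n + 3) ! i" if "i + 2 < length (\<Phi> (n + 3))" for n i
      using fold_step[OF _ inv, of "n + 3"] that by simp
    show "(\<lambda>n. cf_value (\<Phi> (n + 3))) \<longlonglongrightarrow> S" using lim by (rule LIMSEQ_ignore_initial_segment)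
  qed
  then have "\<exists>c. cf_limit \<Phi> c \<and> is_cf_expansion c S"
    unfolding cf_limit_def
    by (simp only: eventually_sequentially_seg[of "\<lambda>n. i < length (\<Phi> n) \<and> \<Phi> n ! i = c i" 3 for c i])
  with summable partial lim inv show ?thesis
    by (auto simp: inv_def)
qed

end
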